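(* Let $m,n\in\mathbb{N}$ with $n>2$ and fix $\mathbf{y}\in\mathbb{R}^m$. If $\psi:\mathbb{N}\to\mathbb{R}_{\geq 0}$ is a function such that \[ \sum_{\mathbf{q}\in\mathbb{Z}^n\setminus\{\mathbf{0}\}}\left(\frac{\varphi(\gcd(\mathbf{q}))\,\psi(|\mathbf{q}|)}{\gcd(\mathbf{q})}\right)^m=\infty, \] then for Lebesgue-almost every $\mathbf{x}\in\operatorname{Mat}_{n\times m}(\mathbb{R})$ there exist infinitely many $(\mathbf{p},\mathbf{q})\in\mathbb{Z}^m\times\mathbb{Z}^n$ with $\gcd(p_i,\mathbf{q})=1$ for every $i=1,\dots,m$ and such that $|\mathbf{q}\mathbf{x}-\mathbf{p}-\mathbf{y}|<\psi(|\mathbf{q}|)$.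
   Context: $\varphi$ is Euler's totient function. For $\mathbf{q}=(q_1,\dots,q_n)\in\mathbb{Z}^n$, $\gcd(\mathbf{q})=\gcd(q_1,\dots,q_n)$ and $\gcd(p_i,\mathbf{q})=\gcd(p_i,q_1,\dots,q_n)$. $\mathbf{q}$ is a row vector so $\mathbf{q}\mathbf{x}\in\mathbb{R}^m$; $|\cdot|$ is the maximum norm. *)

theory Defs
  imports "HOL-Analysis.Analysis" "HOL-Number_Theory.Totient"
begin

definition vec_gcd :: "int ^ 'n \<Rightarrow> int" where
  "vec_gcd q = (GCD i\<in>UNIV. q $ i)"

(* Integer vectors do not form a Euclidean space, so infnorm does not apply to them. The lemma
   infnorm_vec_of_int below states the agreement with infnorm. *)
definition vec_maxnorm :: "int ^ 'n::finite \<Rightarrow> nat" where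
  "vec_maxnorm q = (MAX i. nat \<bar>q $ i\<bar>)"

definition vec_of_int :: "int ^ 'n \<Rightarrow> real ^ 'n" where
  "vec_of_int q = (\<chi> i. of_int (q $ i))"

lemma infnorm_vec_eq_Max:
  fixes x :: "real ^ 'n::finite"
  shows "infnorm x = (MAX i. \<bar>x $ i\<bar>)"
proof -
  have "{\<bar>x $ i\<bar> |i. i \<in> UNIV} = range (\<lambda>i. \<bar>x $ i\<bar>)" by auto
  then show ?thesis
    by (simp add: infnorm_cart cSup_eq_Max)
qed

lemma infnorm_vec_of_int:
  fixes q :: "int ^ 'n::finite"
  shows "infnorm (vec_of_int q) = real (vec_maxnorm q)"
proof -
  have "real (vec_maxnorm q) = Max (real ` range (\<lambda>i. nat \<bar>q $ i\<bar>))"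
    unfolding vec_maxnorm_def by (rule mono_Max_commute) (auto simp: mono_def)
  also have "real ` range (\<lambda>i. nat \<bar>q $ i\<bar>) = range (\<lambda>i. \<bar>vec_of_int q $ i\<bar>)"
    by (simp add: image_image vec_of_int_def)
  finally show ?thesis
    by (simp add: infnorm_vec_eq_Max)
qed

end

theory Submission
  imports Defs "HOL-Probability.Probability_Measure"
begin

text \<open>
  Since \<open>n > 2\<close>, at most a constant times \<open>r^(n-1)\<close> vectors \<open>q\<close> satisfy \<open>|q| = r\<close>, while at least
  \<open>r^(n-1) / 4\<close> of them are primitive with \<open>r\<close> in a fixed coordinate and positive entries elsewhere:
  the imprimitive ones number at most \<open>\<Sum>d\<ge>2. (r/d)^(n-1)\<close>, and \<open>\<Sum>d\<ge>2. 1/d^2 \<le> 3/4\<close>. So the series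
  still diverges when it is restricted to these primitive vectors and \<open>\<psi>\<close> is capped at \<open>1/2\<close>, and
  the coprimality condition becomes vacuous. The chosen vectors are pairwise linearly independent, so
  for any two of them \<open>x \<mapsto> (qx, rx)\<close> is a surjective homomorphism of tori; it preserves Haar measure,
  and hence the events \<open>qx \<in> y + \<int>^m + (-\<psi>, \<psi>)^m\<close> are pairwise independent with probabilities
  \<open>(2\<psi>)^m\<close>. Chebyshev's inequality then gives the divergence half of Borel--Cantelli.
\<close>

subsection \<open>Surjective homomorphisms of tori preserve Lebesgue measure\<close>

text \<open>Phrased through \<open>Basis\<close> so that one notion serves vectors, matrices and
  products of such spaces.\<close>

definition int_lattice :: "'a::euclidean_space set" where
  "int_lattice = {z. \<forall>b\<in>Basis. z \<bullet> b \<in> \<int>}"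

text \<open>Half-open, so that the lattice translates of a cell tile the space without overlap. The
  centre \<open>w\<close> is left free so that a cell can be placed around the target point
  \<open>y\<close>.\<close>

definition unit_cell :: "'a::euclidean_space \<Rightarrow> 'a set" where
  "unit_cell w = {x. \<forall>b\<in>Basis. - (1/2) \<le> x \<bullet> b - w \<bullet> b \<and> x \<bullet> b - w \<bullet> b < 1/2}"

definition lattice_periodic :: "'a::euclidean_space set \<Rightarrow> bool" where
  "lattice_periodic P \<longleftrightarrow> (\<forall>z\<in>int_lattice. \<forall>x. x + z \<in> P \<longleftrightarrow> x \<in> P)"

lemma countable_int_lattice: "countable (int_lattice :: 'a::euclidean_space set)"
proof -
  have "(int_lattice :: 'a set) \<subseteq> (\<lambda>f. \<Sum>b\<in>Basis. f b *\<^sub>R b) ` PiE Basis (\<lambda>_. \<int>)"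
  proof
    fix z :: 'a assume z: "z \<in> int_lattice"
    have "z = (\<Sum>b\<in>Basis. restrict (\<lambda>b. z \<bullet> b) Basis b *\<^sub>R b)"
      by (simp add: euclidean_representation)
    moreover have "restrict (\<lambda>b. z \<bullet> b) Basis \<in> PiE Basis (\<lambda>_. \<int>)"
      using z by (auto simp: int_lattice_def)
    ultimately show "z \<in> (\<lambda>f. \<Sum>b\<in>Basis. f b *\<^sub>R b) ` PiE Basis (\<lambda>_. \<int>)" by blast
  qed
  moreover have "countable (PiE (Basis :: 'a set) (\<lambda>_. \<int> :: real set))"
    by (rule countable_PiE) (auto simp: Ints_def)
  ultimately show ?thesis by (meson countable_image countable_subset)
qed

lemma uminus_int_lattice: "z \<in> int_lattice \<Longrightarrow> - z \<in> int_lattice"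
  by (simp add: int_lattice_def)

lemma unit_cell_borel [measurable]: "unit_cell w \<in> sets borel"
  unfolding unit_cell_def by measurable

lemma unit_cell_add: "x + s \<in> unit_cell (w + s) \<longleftrightarrow> x \<in> unit_cell w"
  by (simp add: unit_cell_def inner_simps)

lemma emeasure_unit_cell: "emeasure lborel (unit_cell (w :: 'a::euclidean_space)) = 1"
proof (rule antisym)
  let ?h = "(1/2) *\<^sub>R One :: 'a"
  have "unit_cell w \<subseteq> cbox (w - ?h) (w + ?h)"
    by (auto simp: unit_cell_def mem_box inner_simps; drule (1) bspec; linarith)
  from emeasure_mono[OF this, of lborel]
  show "emeasure lborel (unit_cell w) \<le> 1"
    by (simp add: emeasure_lborel_cbox_eq inner_simps)
  have "box (w - ?h) (w + ?h) \<subseteq> unit_cell w"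
    by (auto simp: unit_cell_def mem_box inner_simps; drule (1) bspec; linarith)
  from emeasure_mono[OF this, of lborel]
  show "1 \<le> emeasure lborel (unit_cell w)"
    by (simp add: emeasure_lborel_box_eq inner_simps)
qed

text \<open>Rounding \<open>x - w\<close> to the nearest integer in each coordinate finds the cell;
  two integers whose half-open unit intervals share a point coincide.\<close>

lemma ex1_lattice_translate:
  fixes x w :: "'a::euclidean_space"
  shows "\<exists>!z. z \<in> int_lattice \<and> x \<in> unit_cell (w + z)"
proof (rule ex_ex1I)
  \<comment> \<open>The floor after adding 1/2 rounds to the nearest integer with ties going up, in
    agreement with cells that are closed below and open above.\<close>
  define z :: 'a where "z = (\<Sum>b\<in>Basis. of_int \<lfloor>x \<bullet> b - w \<bullet> b + 1/2\<rfloor> *\<^sub>R b)"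
  have z: "z \<bullet> b = of_int \<lfloor>x \<bullet> b - w \<bullet> b + 1/2\<rfloor>" if "b \<in> Basis" for b
    using that by (simp add: z_def)
  have "z \<in> int_lattice" by (simp add: int_lattice_def z)
  moreover have "x \<in> unit_cell (w + z)"
    unfolding unit_cell_def
  proof (intro CollectI ballI)
    fix b :: 'a assume b: "b \<in> Basis"
    have "of_int \<lfloor>x \<bullet> b - w \<bullet> b + 1/2\<rfloor> \<le> x \<bullet> b - w \<bullet> b + 1/2"
      "x \<bullet> b - w \<bullet> b + 1/2 < of_int \<lfloor>x \<bullet> b - w \<bullet> b + 1/2\<rfloor> + 1" by linarith+
    then show "- (1/2) \<le> x \<bullet> b - (w + z) \<bullet> b \<and> x \<bullet> b - (w + z) \<bullet> b < 1/2"
      unfolding inner_add_left z[OF b] by linarith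
  qed
  ultimately show "\<exists>z. z \<in> int_lattice \<and> x \<in> unit_cell (w + z)" by blast
next
  fix z z' :: 'a
  assume a: "z \<in> int_lattice \<and> x \<in> unit_cell (w + z)" "z' \<in> int_lattice \<and> x \<in> unit_cell (w + z')"
  show "z = z'"
  proof (rule euclidean_eqI)
    fix b :: 'a assume b: "b \<in> Basis"
    obtain k k' where k: "z \<bullet> b = of_int k" "z' \<bullet> b = of_int k'"
      using a b unfolding int_lattice_def by (blast elim: Ints_cases)
    have "- (1/2) \<le> x \<bullet> b - (w \<bullet> b + of_int k)" "x \<bullet> b - (w \<bullet> b + of_int k) < 1/2"
      "- (1/2) \<le> x \<bullet> b - (w \<bullet> b + of_int k')" "x \<bullet> b - (w \<bullet> b + of_int k') < 1/2"
      using a b k by (auto simp: unit_cell_def inner_simps)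
    then have "k = k'" by linarith
    then show "z \<bullet> b = z' \<bullet> b" using k by simp
  qed
qed

lemma emeasure_lborel_translate:
  fixes S :: "'a::euclidean_space set"
  assumes "S \<in> sets borel"
  shows "emeasure lborel {x. x + s \<in> S} = emeasure lborel S"
proof -
  have "emeasure lborel S = emeasure (distr lborel borel ((+) s)) S"
    by (simp add: lborel_distr_plus)
  also have "\<dots> = emeasure lborel ((+) s -` S)"
    using assms by (subst emeasure_distr) auto
  also have "(+) s -` S = {x. x + s \<in> S}" by (auto simp: add.commute)
  finally show ?thesis by simp
qed

text \<open>Two fundamental domains are equidecomposable: the tiling by translates of the cell at
  \<open>v\<close> cuts the cell at \<open>w\<close> into countably many pieces, and moving each
  piece back by its lattice vector reassembles the cell at \<open>v\<close>. Periodicity makes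
  \<open>P\<close> follow the moves.\<close>

lemma emeasure_unit_cell_Int_periodic:
  fixes P :: "'a::euclidean_space set"
  assumes [measurable]: "P \<in> sets borel" and per: "lattice_periodic P"
  shows "emeasure lborel (unit_cell w \<inter> P) = emeasure lborel (unit_cell v \<inter> P)"
proof -
  have disj: "disjoint_family_on (\<lambda>z. unit_cell (u + z) \<inter> A) (int_lattice)" for u :: 'a and A
    unfolding disjoint_family_on_def using ex1_lattice_translate[of _ u] by blast
  have disj': "disjoint_family_on (\<lambda>z. unit_cell (u - z) \<inter> A) (int_lattice)" for u :: 'a and A
    unfolding disjoint_family_on_def
  proof (intro ballI impI, rule ccontr)
    fix z z' :: 'a
    assume z: "z \<in> int_lattice" "z' \<in> int_lattice" "z \<noteq> z'"
      "unit_cell (u - z) \<inter> A \<inter> (unit_cell (u - z') \<inter> A) \<noteq> {}"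
    then obtain x where "x \<in> unit_cell (u + - z)" "x \<in> unit_cell (u + - z')" by auto
    then have "- z = - z'"
      using ex1_lattice_translate[of x u] uminus_int_lattice z by blast
    then show False using z by simp
  qed
  have "unit_cell w \<inter> P = (\<Union>z\<in>int_lattice. unit_cell (v + z) \<inter> (unit_cell w \<inter> P))"
    using ex1_lattice_translate[of _ v] by blast
  then have "emeasure lborel (unit_cell w \<inter> P) =
      emeasure lborel (\<Union>z\<in>int_lattice. unit_cell (v + z) \<inter> (unit_cell w \<inter> P))"
    by (rule arg_cong)
  also have "\<dots> = (\<integral>\<^sup>+z. emeasure lborel (unit_cell (v + z) \<inter> (unit_cell w \<inter> P)) \<partial>count_space int_lattice)"
    by (rule emeasure_UN_countable[OF _ countable_int_lattice disj]) simp
  also have "\<dots> = (\<integral>\<^sup>+z. emeasure lborel (unit_cell (w - z) \<inter> (unit_cell v \<inter> P)) \<partial>count_space int_lattice)"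
  proof (rule nn_integral_cong)
    fix z :: 'a assume "z \<in> space (count_space int_lattice)"
    then have z: "z \<in> int_lattice" by simp
    have "emeasure lborel (unit_cell (v + z) \<inter> (unit_cell w \<inter> P)) =
        emeasure lborel {x. x + z \<in> unit_cell (v + z) \<inter> (unit_cell w \<inter> P)}"
      by (rule emeasure_lborel_translate[symmetric]) measurable
    also have "{x. x + z \<in> unit_cell (v + z) \<inter> (unit_cell w \<inter> P)} = unit_cell (w - z) \<inter> (unit_cell v \<inter> P)"
      using per z unit_cell_add[of _ z "w - z"] by (auto simp: lattice_periodic_def unit_cell_add)
    finally show "emeasure lborel (unit_cell (v + z) \<inter> (unit_cell w \<inter> P)) =
        emeasure lborel (unit_cell (w - z) \<inter> (unit_cell v \<inter> P))" .
  qed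
  also have "\<dots> = emeasure lborel (\<Union>z\<in>int_lattice. unit_cell (w - z) \<inter> (unit_cell v \<inter> P))"
    by (rule emeasure_UN_countable[symmetric, OF _ countable_int_lattice disj']) simp
  also have "(\<Union>z\<in>int_lattice. unit_cell (w - z) \<inter> (unit_cell v \<inter> P)) = unit_cell v \<inter> P"
  proof -
    have "\<exists>z\<in>int_lattice. x \<in> unit_cell (w - z)" for x
      using ex1_lattice_translate[of x w] uminus_int_lattice
      by (metis add_uminus_conv_diff minus_minus)
    then show ?thesis by blast
  qed
  finally show ?thesis .
qed

text \<open>Substituting \<open>x + s\<close> moves the cell instead of the set, and the position of
  the cell is immaterial for a periodic set.\<close>

lemma emeasure_unit_cell_translate:
  fixes P :: "'a::euclidean_space set"
  assumes [measurable]: "P \<in> sets borel" and per: "lattice_periodic P"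
  shows "emeasure lborel {x \<in> unit_cell w. x + s \<in> P} = emeasure lborel (unit_cell v \<inter> P)"
proof -
  have "{x \<in> unit_cell w. x + s \<in> P} = {x. x + s \<in> unit_cell (w + s) \<inter> P}"
    by (auto simp: unit_cell_add)
  also have "emeasure lborel \<dots> = emeasure lborel (unit_cell (w + s) \<inter> P)"
    by (rule emeasure_lborel_translate) measurable
  also have "\<dots> = emeasure lborel (unit_cell v \<inter> P)"
    by (rule emeasure_unit_cell_Int_periodic) fact+
  finally show ?thesis .
qed

text \<open>Uniqueness of Haar measure: averaging over the translates of \<open>P\<close> can be carried out in the target
  or, \<open>T\<close> being onto, in the source.\<close>
lemma emeasure_unit_cell_surj_linear:
  fixes T :: "'a::euclidean_space \<Rightarrow> 'b::euclidean_space" and P :: "'b set"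
  assumes T: "linear T" "surj T" and TL: "T ` int_lattice \<subseteq> int_lattice"
    and [measurable]: "P \<in> sets borel" and per: "lattice_periodic P"
  shows "emeasure lborel {x \<in> unit_cell w. T x \<in> P} = emeasure lborel (unit_cell v \<inter> P)"
proof -
  have [measurable]: "T \<in> borel_measurable borel"
    using T(1) by (intro borel_measurable_continuous_onI linear_continuous_on) (simp add: linear_conv_bounded_linear)
  define Q where "Q = T -` P"
  have [measurable]: "Q \<in> sets borel"
    unfolding Q_def using measurable_sets[of T borel borel P] by simp
  have perQ: "lattice_periodic Q"
    using per TL T(1) by (auto simp: lattice_periodic_def Q_def linear_add)
  \<comment> \<open>Tonelli's theorem is applied to \<open>H\<close> in both orders: sections at
    fixed \<open>x\<close> lie in the target cell, sections at fixed \<open>t\<close> in the source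
    cell, and in each case the measure does not depend on the fixed point.\<close>
  define H where "H = {(x, t). x \<in> unit_cell w \<and> t \<in> unit_cell v \<and> t + T x \<in> P}"
  have H: "H \<in> sets (lborel \<Otimes>\<^sub>M lborel)"
  proof -
    have "{z \<in> space (lborel \<Otimes>\<^sub>M lborel). fst z \<in> unit_cell w \<and> snd z \<in> unit_cell v \<and> snd z + T (fst z) \<in> P}
        \<in> sets (lborel \<Otimes>\<^sub>M lborel)" by measurable
    also have "{z \<in> space (lborel \<Otimes>\<^sub>M lborel). fst z \<in> unit_cell w \<and> snd z \<in> unit_cell v \<and> snd z + T (fst z) \<in> P} = H"
      by (auto simp: H_def space_pair_measure)
    finally show ?thesis .
  qed
  have "emeasure (lborel \<Otimes>\<^sub>M lborel) H = (\<integral>\<^sup>+x. emeasure lborel (Pair x -` H) \<partial>lborel)"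
    by (rule lborel.emeasure_pair_measure_alt[OF H])
  also have "\<dots> = (\<integral>\<^sup>+x. emeasure lborel (unit_cell v \<inter> P) * indicator (unit_cell w) x \<partial>lborel)"
  proof (rule nn_integral_cong)
    fix x
    have "Pair x -` H = (if x \<in> unit_cell w then {t \<in> unit_cell v. t + T x \<in> P} else {})"
      by (auto simp: H_def)
    then show "emeasure lborel (Pair x -` H) = emeasure lborel (unit_cell v \<inter> P) * indicator (unit_cell w) x"
      using emeasure_unit_cell_translate[OF _ per] by simp
  qed
  also have "\<dots> = emeasure lborel (unit_cell v \<inter> P)"
    by (simp add: nn_integral_cmult_indicator emeasure_unit_cell)
  finally have 1: "emeasure (lborel \<Otimes>\<^sub>M lborel) H = emeasure lborel (unit_cell v \<inter> P)" .
  have "emeasure (lborel \<Otimes>\<^sub>M lborel) H = (\<integral>\<^sup>+t. emeasure lborel ((\<lambda>x. (x, t)) -` H) \<partial>lborel)"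
    by (rule lborel_pair.emeasure_pair_measure_alt2[OF H])
  also have "\<dots> = (\<integral>\<^sup>+t. emeasure lborel (unit_cell w \<inter> Q) * indicator (unit_cell v) t \<partial>lborel)"
  proof (rule nn_integral_cong)
    fix t
    \<comment> \<open>Surjectivity of \<open>T\<close> enters here: the shift by \<open>t\<close> in
      the target becomes a shift by \<open>s\<close> in the source.\<close>
    obtain s where s: "t = T s" using T(2) by auto
    have "(\<lambda>x. (x, t)) -` H = (if t \<in> unit_cell v then {x \<in> unit_cell w. x + s \<in> Q} else {})"
      using T(1) by (auto simp: H_def Q_def s linear_add add.commute)
    then show "emeasure lborel ((\<lambda>x. (x, t)) -` H) = emeasure lborel (unit_cell w \<inter> Q) * indicator (unit_cell v) t"
      using emeasure_unit_cell_translate[OF _ perQ] by simp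
  qed
  also have "\<dots> = emeasure lborel (unit_cell w \<inter> Q)"
    by (simp add: nn_integral_cmult_indicator emeasure_unit_cell)
  also have "unit_cell w \<inter> Q = {x \<in> unit_cell w. T x \<in> P}" by (auto simp: Q_def)
  finally show ?thesis using 1 by simp
qed

subsection \<open>Borel--Cantelli for pairwise independent events\<close>

text \<open>Chebyshev's inequality for the number \<open>f\<close> of events that occur: its mean is
  \<open>S\<close>, its variance is at most \<open>S\<close>, and where no event occurs it deviates
  from the mean by \<open>S\<close>. The product form avoids dividing by a sum that may
  vanish.\<close>

lemma (in prob_space) prob_none_pairwise_indep_le:
  assumes F: "finite F" and A: "\<And>q. q \<in> F \<Longrightarrow> A q \<in> events"
    and indep: "\<And>q r. q \<in> F \<Longrightarrow> r \<in> F \<Longrightarrow> q \<noteq> r \<Longrightarrow> prob (A q \<inter> A r) = prob (A q) * prob (A r)"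
  shows "prob {x \<in> space M. \<forall>q\<in>F. x \<notin> A q} * (\<Sum>q\<in>F. prob (A q)) \<le> 1"
proof -
  define S where "S = (\<Sum>q\<in>F. prob (A q))"
  define N where "N = {x \<in> space M. \<forall>q\<in>F. x \<notin> A q}"
  define f :: "'a \<Rightarrow> real" where "f x = (\<Sum>q\<in>F. indicator (A q) x)" for x
  have S0: "S \<ge> 0" unfolding S_def by (simp add: sum_nonneg)
  have "N = space M - (\<Union>q\<in>F. A q)" by (auto simp: N_def)
  then have N: "N \<in> events" using F A by auto
  have int1: "integrable M (indicator B :: 'a \<Rightarrow> real)" if "B \<in> events" for B
    using that by (simp add: integrable_indicator_iff emeasure_eq_measure)
  have intf: "integrable M f" unfolding f_def using A int1 by auto
  have Ef: "expectation f = S"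
    unfolding f_def S_def using A int1 by (subst Bochner_Integration.integral_sum) auto
  have f2: "(f x)\<^sup>2 = (\<Sum>q\<in>F. \<Sum>r\<in>F. indicator (A q \<inter> A r) x)" for x
    by (simp add: f_def power2_eq_square sum_product indicator_inter_arith)
  have intf2: "integrable M (\<lambda>x. (f x)\<^sup>2)"
    unfolding f2 using A by (intro Bochner_Integration.integrable_sum int1) auto
  have "expectation (\<lambda>x. (f x)\<^sup>2) = (\<Sum>q\<in>F. \<Sum>r\<in>F. prob (A q \<inter> A r))"
    unfolding f2
  proof (subst Bochner_Integration.integral_sum)
    show "integrable M (\<lambda>x. \<Sum>r\<in>F. indicat_real (A q \<inter> A r) x)" if "q \<in> F" for q
      using A that by (intro Bochner_Integration.integrable_sum int1) auto
    show "(\<Sum>q\<in>F. expectation (\<lambda>x. \<Sum>r\<in>F. indicat_real (A q \<inter> A r) x))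
        = (\<Sum>q\<in>F. \<Sum>r\<in>F. prob (A q \<inter> A r))"
    proof (rule sum.cong[OF refl])
      fix q assume q: "q \<in> F"
      show "expectation (\<lambda>x. \<Sum>r\<in>F. indicat_real (A q \<inter> A r) x) = (\<Sum>r\<in>F. prob (A q \<inter> A r))"
        using A q by (subst Bochner_Integration.integral_sum) (auto intro!: int1 sum.cong)
    qed
  qed
  \<comment> \<open>Off the diagonal this is independence; on the diagonal
    \<open>A q \<inter> A q\<close> has probability \<open>prob (A q)\<close>, and the added square
    only enlarges the bound.\<close>
  also have "\<dots> \<le> (\<Sum>q\<in>F. \<Sum>r\<in>F. prob (A q) * prob (A r) + (if q = r then prob (A q) else 0))"
    by (intro sum_mono) (auto simp: indep)
  also have "\<dots> = S\<^sup>2 + S"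
    using F by (simp add: sum.distrib S_def power2_eq_square sum_product)
  finally have Ef2: "expectation (\<lambda>x. (f x)\<^sup>2) \<le> S\<^sup>2 + S" .
  have "S\<^sup>2 * prob N = expectation (\<lambda>x. S\<^sup>2 * indicator N x)"
    using N by simp
  also have "\<dots> \<le> expectation (\<lambda>x. (f x)\<^sup>2 - 2 * S * f x + S\<^sup>2)"
  proof (rule integral_mono)
    show "integrable M (\<lambda>x. S\<^sup>2 * indicat_real N x)" using int1[OF N] by simp
    show "integrable M (\<lambda>x. (f x)\<^sup>2 - 2 * S * f x + S\<^sup>2)" using intf intf2 by simp
    fix x
    have "f x = 0" if "x \<in> N" using that by (simp add: f_def N_def)
    moreover have "(f x)\<^sup>2 - 2 * S * f x + S\<^sup>2 = (f x - S)\<^sup>2"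
      by (simp add: power2_eq_square algebra_simps)
    ultimately show "S\<^sup>2 * indicat_real N x \<le> (f x)\<^sup>2 - 2 * S * f x + S\<^sup>2"
      by (cases "x \<in> N") auto
  qed
  also have "\<dots> = expectation (\<lambda>x. (f x)\<^sup>2) - 2 * S * S + S\<^sup>2"
    using intf intf2 by (simp add: Ef prob_space)
  also have "\<dots> \<le> S" using Ef2 by (simp add: power2_eq_square)
  finally have "S * (S * prob N) \<le> S * 1" by (simp add: power2_eq_square)
  then have "S * prob N \<le> 1" using S0 by (cases "S = 0") (auto simp: mult_le_cancel_left)
  then show ?thesis by (simp add: S_def N_def mult.commute)
qed

text \<open>Discarding a finite index set \<open>G\<close> keeps the sums unbounded, so almost
  surely some event with index outside \<open>G\<close> occurs, and this holds for all finite
  \<open>G\<close> at once because there are only countably many.\<close>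

lemma (in prob_space) AE_infinite_pairwise_indep:
  assumes Q: "countable Q" and A: "\<And>q. q \<in> Q \<Longrightarrow> A q \<in> events"
    and indep: "\<And>q r. q \<in> Q \<Longrightarrow> r \<in> Q \<Longrightarrow> q \<noteq> r \<Longrightarrow> prob (A q \<inter> A r) = prob (A q) * prob (A r)"
    and div: "\<And>K. \<exists>F. finite F \<and> F \<subseteq> Q \<and> K \<le> (\<Sum>q\<in>F. prob (A q))"
  shows "AE x in M. infinite {q \<in> Q. x \<in> A q}"
proof -
  have null: "AE x in M. \<exists>q\<in>Q - G. x \<in> A q" if G: "finite G" for G
  proof -
    define N where "N = {x \<in> space M. \<forall>q\<in>Q - G. x \<notin> A q}"
    have N: "N \<in> events"
    proof -
      have "N = space M - (\<Union>q\<in>Q - G. A q)" by (auto simp: N_def)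
      moreover have "(\<Union>q\<in>Q - G. A q) \<in> events"
        using Q A by (intro sets.countable_UN') auto
      ultimately show ?thesis by simp
    qed
    have bound: "prob N * K \<le> 1" if "K \<ge> 0" for K
    proof -
      \<comment> \<open>The surplus \<open>card G\<close> pays for the indices in \<open>G\<close>,
        each of which contributes at most 1.\<close>
      obtain F where F: "finite F" "F \<subseteq> Q" "K + real (card G) \<le> (\<Sum>q\<in>F. prob (A q))"
        using div by blast
      have "(\<Sum>q\<in>F. prob (A q)) = (\<Sum>q\<in>F - G. prob (A q)) + (\<Sum>q\<in>F \<inter> G. prob (A q))"
        using F(1) by (metis add.commute sum.Int_Diff)
      also have "(\<Sum>q\<in>F \<inter> G. prob (A q)) \<le> real (card (F \<inter> G))"
        using sum_bounded_above[of "F \<inter> G" "\<lambda>q. prob (A q)" 1] by simp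
      also have "\<dots> \<le> real (card G)" using G by (simp add: card_mono)
      finally have K: "K \<le> (\<Sum>q\<in>F - G. prob (A q))" using F(3) by linarith
      have "prob N \<le> prob {x \<in> space M. \<forall>q\<in>F - G. x \<notin> A q}"
      proof (rule finite_measure_mono)
        show "N \<subseteq> {x \<in> space M. \<forall>q\<in>F - G. x \<notin> A q}" using F(2) by (auto simp: N_def)
        have "{x \<in> space M. \<forall>q\<in>F - G. x \<notin> A q} = space M - (\<Union>q\<in>F - G. A q)" by auto
        also have "\<dots> \<in> events" using F A by (intro sets.Diff sets.finite_UN) auto
        finally show "{x \<in> space M. \<forall>q\<in>F - G. x \<notin> A q} \<in> events" .
      qed
      then have "prob N * K \<le> prob {x \<in> space M. \<forall>q\<in>F - G. x \<notin> A q} * (\<Sum>q\<in>F - G. prob (A q))"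
        using K \<open>K \<ge> 0\<close> by (intro mult_mono) auto
      also have "\<dots> \<le> 1"
        using F A by (intro prob_none_pairwise_indep_le) (auto intro!: indep)
      finally show ?thesis .
    qed
    have "prob N = 0"
    proof (rule ccontr)
      assume "prob N \<noteq> 0"
      then have "prob N > 0" using zero_less_measure_iff by blast
      \<comment> \<open>With this \<open>K\<close> the bound would read 2 \<le> 1.\<close>
      then show False using bound[of "2 / prob N"] by simp
    qed
    then have "AE x in M. x \<notin> N"
      using N by (intro AE_not_in) (simp add: null_sets_def emeasure_eq_measure)
    then show ?thesis using AE_space by eventually_elim (auto simp: N_def)
  qed
  have "AE x in M. \<forall>G\<in>{G. G \<subseteq> Q \<and> finite G}. \<exists>q\<in>Q - G. x \<in> A q"
  proof (subst AE_ball_countable)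
    show "countable {G. G \<subseteq> Q \<and> finite G}"
      using countable_Collect_finite_subset[OF Q] by (simp add: conj_commute)
    show "\<forall>G\<in>{G. G \<subseteq> Q \<and> finite G}. AE x in M. \<exists>q\<in>Q - G. x \<in> A q"
      using null by blast
  qed
  then show ?thesis
  proof eventually_elim
    case (elim x)
    show ?case
    proof
      assume fin: "finite {q \<in> Q. x \<in> A q}"
      \<comment> \<open>The set of indices that occur, if finite, is itself an admissible
        \<open>G\<close>.\<close>
      then have "\<exists>q\<in>Q - {q \<in> Q. x \<in> A q}. x \<in> A q" by (intro bspec[OF elim]) auto
      then show False by blast
    qed
  qed
qed

subsection \<open>Counting primitive vectors\<close>

lemma finite_card_vec_box:
  fixes S :: "'n::finite \<Rightarrow> int set"
  assumes "\<And>i. finite (S i)"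
  shows "finite {v :: int ^ 'n. \<forall>i. v $ i \<in> S i}"
    and "card {v :: int ^ 'n. \<forall>i. v $ i \<in> S i} = (\<Prod>i\<in>UNIV. card (S i))"
proof -
  have "bij_betw (\<lambda>v i. v $ i) {v :: int ^ 'n. \<forall>i. v $ i \<in> S i} (PiE UNIV S)"
    by (rule bij_betwI[where g = vec_lambda]) auto
  moreover have "finite (PiE UNIV S)" by (rule finite_PiE) (use assms in auto)
  ultimately show "finite {v :: int ^ 'n. \<forall>i. v $ i \<in> S i}"
    "card {v :: int ^ 'n. \<forall>i. v $ i \<in> S i} = (\<Prod>i\<in>UNIV. card (S i))"
    by (simp_all add: bij_betw_finite bij_betw_same_card card_PiE)
qed

text \<open>The shape of all later counts: one distinguished coordinate carries the norm, the others
  range over a common set.\<close>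

lemma finite_card_vec_pinned:
  fixes i :: "'n::finite" and A B :: "int set"
  assumes "finite A" "finite B"
  defines "V \<equiv> {v :: int ^ 'n. v $ i \<in> A \<and> (\<forall>j. j \<noteq> i \<longrightarrow> v $ j \<in> B)}"
  shows "finite V" and "card V = card A * card B ^ (CARD('n) - 1)"
proof -
  let ?S = "\<lambda>j. if j = i then A else B"
  have V: "V = {v. \<forall>j. v $ j \<in> ?S j}" by (auto simp: V_def)
  show "finite V" unfolding V by (rule finite_card_vec_box) (use assms in auto)
  have "card V = (\<Prod>j\<in>UNIV. card (?S j))"
    unfolding V by (rule finite_card_vec_box) (use assms in auto)
  also have "\<dots> = card A * (\<Prod>j\<in>UNIV - {i}. card (?S j))"
    by (subst prod.remove[of _ i]) auto
  also have "(\<Prod>j\<in>UNIV - {i}. card (?S j)) = (\<Prod>j\<in>UNIV - {i}. card B)"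
    by (rule prod.cong) auto
  finally show "card V = card A * card B ^ (CARD('n) - 1)" by (simp add: card_Diff_singleton)
qed

lemma vec_gcd_dvd: "vec_gcd q dvd q $ i"
  unfolding vec_gcd_def by (rule Gcd_dvd) auto

lemma vec_gcd_nonneg: "vec_gcd q \<ge> 0"
  unfolding vec_gcd_def by simp

lemma sum_inverse_squares_from_2: "(\<Sum>d=2..r. 1 / (real d)\<^sup>2) \<le> 3 / 4"
proof -
  \<comment> \<open>The subtracted term makes the induction telescope through 1/d^2 \<le> 1/(d-1) -
    1/d; at the start it is an equality, 1/4 = 3/4 - 1/2.\<close>
  have "(\<Sum>d=2..Suc (Suc r). 1 / (real d)\<^sup>2) \<le> 3 / 4 - 1 / real (r + 2)" for r
  proof (induction r)
    case 0
    show ?case by (simp add: numeral_2_eq_2)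
  next
    case (Suc r)
    have "1 / (real (r + 3))\<^sup>2 \<le> 1 / (real (r + 2) * real (r + 3))"
      by (intro divide_left_mono) (auto simp: power2_eq_square intro!: mult_pos_pos)
    also have "\<dots> = 1 / real (r + 2) - 1 / real (r + 3)" by (simp add: divide_simps)
    finally show ?case using Suc by (simp add: algebra_simps)
  qed
  note bound = this
  show ?thesis
  proof (cases "r < 2")
    case False
    then obtain s where r: "r = Suc (Suc s)" by (metis add_2_eq_Suc le_Suc_ex not_less)
    have "0 \<le> 1 / real (s + 2)" by simp
    then show ?thesis using bound[of s] unfolding r by linarith
  qed simp
qed

text \<open>Pinning coordinate \<open>i\<close> to \<open>r\<close> and keeping the others in
  \<open>{1..int r}\<close> fixes the norm and excludes the pair of a vector and its negative. Gcd 1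
  makes the coprimality condition on \<open>p\<close> automatic.\<close>

definition primitive_slice :: "'n \<Rightarrow> nat \<Rightarrow> (int ^ 'n::finite) set" where
  "primitive_slice i r = {q. q $ i = int r \<and> (\<forall>j. j \<noteq> i \<longrightarrow> q $ j \<in> {1..int r}) \<and> vec_gcd q = 1}"

lemma finite_primitive_slice: "finite (primitive_slice (i :: 'n::finite) r)"
proof (rule finite_subset)
  show "primitive_slice i r \<subseteq> {q. q $ i \<in> {int r} \<and> (\<forall>j. j \<noteq> i \<longrightarrow> q $ j \<in> {1..int r})}"
    by (auto simp: primitive_slice_def)
qed (rule finite_card_vec_pinned, auto)

lemma vec_maxnorm_primitive_slice:
  assumes "q \<in> primitive_slice i r"
  shows "vec_maxnorm q = r"
  unfolding vec_maxnorm_def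
proof (rule Max_eqI)
  fix k assume "k \<in> range (\<lambda>i. nat \<bar>q $ i\<bar>)"
  then obtain j where "k = nat \<bar>q $ j\<bar>" by auto
  then show "k \<le> r" using assms by (cases "j = i") (auto simp: primitive_slice_def)
next
  show "r \<in> range (\<lambda>i. nat \<bar>q $ i\<bar>)"
    using assms by (auto simp: primitive_slice_def image_iff intro!: exI[of _ i])
qed simp

text \<open>Of the \<open>r ^ (CARD('n) - 1)\<close> candidates, those with gcd \<open>d\<close>
  have all free coordinates among the multiples of \<open>d\<close>, which leaves at most a fraction
  1/d^2 of them. Summed over \<open>d\<close>, at most three quarters are lost.\<close>

lemma card_primitive_slice_ge:
  fixes i :: "'n::finite"
  assumes n: "CARD('n) > 2" and r: "r \<ge> 1"
  shows "real r ^ (CARD('n) - 1) / 4 \<le> real (card (primitive_slice i r))"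
proof -
  let ?k = "CARD('n) - 1"
  let ?V = "\<lambda>B. {q :: int ^ 'n. q $ i \<in> {int r} \<and> (\<forall>j. j \<noteq> i \<longrightarrow> q $ j \<in> B)}"
  let ?D = "\<lambda>d. {k \<in> {1..int r}. int d dvd k}"
  have fin: "finite (?V B)" if "finite B" for B by (rule finite_card_vec_pinned) (use that in auto)
  have card: "card (?V B) = card B ^ ?k" if "finite B" for B
    using finite_card_vec_pinned(2)[of "{int r}" B i] that by simp
  have finD: "finite (?D d)" for d by (rule finite_subset[of _ "{1..int r}"]) auto
  have "?V {1..int r} \<subseteq> primitive_slice i r \<union> (\<Union>d\<in>{2..r}. ?V (?D d))"
  proof
    fix q assume q: "q \<in> ?V {1..int r}"
    show "q \<in> primitive_slice i r \<union> (\<Union>d\<in>{2..r}. ?V (?D d))"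
    proof (cases "vec_gcd q = 1")
      case True
      then show ?thesis using q by (auto simp: primitive_slice_def)
    next
      case False
      \<comment> \<open>The pinned coordinate equals \<open>r\<close>, so the gcd divides
        \<open>r\<close>; this confines \<open>d\<close> to a finite range.\<close>
      have dv: "vec_gcd q dvd int r" using q vec_gcd_dvd[of q i] by simp
      then have "vec_gcd q \<noteq> 0" using r by auto
      moreover have "vec_gcd q \<le> int r" using dv r by (intro zdvd_imp_le) auto
      ultimately have "nat (vec_gcd q) \<in> {2..r}" using False vec_gcd_nonneg[of q] by auto
      moreover have "q \<in> ?V (?D (nat (vec_gcd q)))"
        using q vec_gcd_nonneg[of q] by (auto intro: vec_gcd_dvd)
      ultimately show ?thesis by blast
    qed
  qed
  then have "card (?V {1..int r}) \<le> card (primitive_slice i r \<union> (\<Union>d\<in>{2..r}. ?V (?D d)))"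
    by (rule card_mono[rotated]) (intro finite_UnI finite_UN_I finite_primitive_slice fin finD; simp)
  also have "\<dots> \<le> card (primitive_slice i r) + card (\<Union>d\<in>{2..r}. ?V (?D d))"
    by (rule card_Un_le)
  also have "card (\<Union>d\<in>{2..r}. ?V (?D d)) \<le> (\<Sum>d=2..r. card (?V (?D d)))"
    by (rule card_UN_le) simp
  finally have "real (card (?V {1..int r})) \<le> real (card (primitive_slice i r)) + (\<Sum>d=2..r. real (card (?V (?D d))))"
    by (simp flip: of_nat_sum of_nat_add del: of_nat_power)
  also have "real (card (?V {1..int r})) = real r ^ ?k" by (subst card) auto
  also have "(\<Sum>d=2..r. real (card (?V (?D d)))) \<le> (\<Sum>d=2..r. real r ^ ?k * (1 / (real d)\<^sup>2))"
  proof (rule sum_mono)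
    fix d assume d: "d \<in> {2..r}"
    have "?D d \<subseteq> (\<lambda>k. int d * k) ` {1..int (r div d)}"
    proof
      fix k assume k: "k \<in> ?D d"
      then obtain l where l: "k = int d * l" by (auto elim: dvdE)
      have "l \<le> int r div int d"
        using k l d zdiv_mono1[of "int d * l" "int r" "int d"] by simp
      moreover have "l \<ge> 1" using k l mult_nonneg_nonpos[of "int d" l] by (cases "l \<ge> 1") auto
      ultimately show "k \<in> (\<lambda>k. int d * k) ` {1..int (r div d)}"
        using l by (auto simp: zdiv_int)
    qed
    then have "card (?D d) \<le> card ((\<lambda>k. int d * k) ` {1..int (r div d)})" by (intro card_mono) auto
    also have "\<dots> \<le> r div d" using card_image_le[of "{1..int (r div d)}" "\<lambda>k. int d * k"] by simp
    finally have "real (card (?D d)) \<le> real r / real d"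
      by (meson of_nat_div_le_of_nat of_nat_mono order_trans)
    then have "real (card (?D d)) ^ ?k \<le> (real r / real d) ^ ?k" by (intro power_mono) auto
    also have "\<dots> = real r ^ ?k * (1 / real d ^ ?k)" by (simp add: power_divide)
    \<comment> \<open>More than two coordinates means that the exponent \<open>?k\<close> is at
      least 2.\<close>
    also have "\<dots> \<le> real r ^ ?k * (1 / (real d)\<^sup>2)"
      using d n by (intro mult_left_mono divide_left_mono power_increasing) auto
    finally show "real (card (?V (?D d))) \<le> real r ^ ?k * (1 / (real d)\<^sup>2)"
      by (subst card[OF finD]) simp
  qed
  also have "\<dots> \<le> real r ^ ?k * (3 / 4)"
    unfolding sum_distrib_left[symmetric] by (intro mult_left_mono sum_inverse_squares_from_2) simp
  finally show ?thesis by simp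
qed

text \<open>Some coordinate attains the norm, with two choices of sign; each other one has
  \<open>2 * r + 1\<close> values, at most \<open>3 * r\<close> since \<open>r\<close> is
  positive.\<close>

lemma maxnorm_sphere:
  fixes r :: nat
  assumes "r \<ge> 1"
  shows "finite {q :: int ^ 'n::finite. vec_maxnorm q = r}"
    and "real (card {q :: int ^ 'n. vec_maxnorm q = r})
           \<le> real CARD('n) * 2 * 3 ^ (CARD('n) - 1) * real r ^ (CARD('n) - 1)"
proof -
  let ?k = "CARD('n) - 1"
  let ?V = "\<lambda>i. {q :: int ^ 'n. q $ i \<in> {- int r, int r} \<and> (\<forall>j. j \<noteq> i \<longrightarrow> q $ j \<in> {- int r..int r})}"
  have fin: "finite (?V i)" for i by (rule finite_card_vec_pinned) auto
  have card: "card (?V i) = 2 * (2 * r + 1) ^ ?k" for i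
  proof -
    have "nat (int r + 1 - - int r) = 2 * r + 1" by linarith
    then show ?thesis
      using finite_card_vec_pinned(2)[of "{- int r, int r}" "{- int r..int r}" i] assms
      by (simp add: card_insert_if)
  qed
  have sub: "{q :: int ^ 'n. vec_maxnorm q = r} \<subseteq> (\<Union>i. ?V i)"
  proof
    fix q :: "int ^ 'n" assume "q \<in> {q. vec_maxnorm q = r}"
    then have q: "(MAX i. nat \<bar>q $ i\<bar>) = r" by (simp add: vec_maxnorm_def)
    have "(MAX i. nat \<bar>q $ i\<bar>) \<in> range (\<lambda>i. nat \<bar>q $ i\<bar>)" by (rule Max_in) auto
    then obtain i where i: "nat \<bar>q $ i\<bar> = r" using q by auto
    have "nat \<bar>q $ j\<bar> \<le> r" for j unfolding q[symmetric] by (rule Max_ge) auto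
    then have "q $ j \<in> {- int r..int r}" for j by (smt (verit) atLeastAtMost_iff nat_le_iff)
    moreover have "q $ i \<in> {- int r, int r}" using i by auto
    ultimately show "q \<in> (\<Union>i. ?V i)" by blast
  qed
  show "finite {q :: int ^ 'n. vec_maxnorm q = r}" using sub by (rule finite_subset) (intro finite_UN_I fin; simp)
  have "card {q :: int ^ 'n. vec_maxnorm q = r} \<le> card (\<Union>i. ?V i)"
    using sub by (rule card_mono[rotated]) (use fin in auto)
  also have "\<dots> \<le> (\<Sum>i\<in>UNIV. card (?V i))" by (rule card_UN_le) simp
  also have "\<dots> = CARD('n) * (2 * (2 * r + 1) ^ ?k)" by (simp only: card sum_constant of_nat_id)
  also have "\<dots> \<le> CARD('n) * (2 * (3 * r) ^ ?k)"
    using assms by (intro mult_left_mono power_mono) auto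
  finally have "real (card {q :: int ^ 'n. vec_maxnorm q = r}) \<le> real (CARD('n) * (2 * (3 * r) ^ ?k))"
    by (simp only: of_nat_le_iff)
  then show "real (card {q :: int ^ 'n. vec_maxnorm q = r})
      \<le> real CARD('n) * 2 * 3 ^ ?k * real r ^ ?k" by (simp add: power_mult_distrib mult.assoc)
qed

section \<open>Transfer of divergence to primitive vectors\<close>

lemma totient_ratio_le:
  assumes "c \<ge> 0"
  shows "real (totient (nat (vec_gcd q))) * c / real_of_int (vec_gcd q) \<le> c"
proof (cases "vec_gcd q = 0")
  case False
  then have g: "real_of_int (vec_gcd q) > 0" using vec_gcd_nonneg[of q] by simp
  have "real (totient (nat (vec_gcd q))) \<le> real (nat (vec_gcd q))"
    by (simp only: of_nat_le_iff totient_le)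
  also have "\<dots> = real_of_int (vec_gcd q)" using vec_gcd_nonneg[of q] by simp
  finally show ?thesis using g assms by (simp add: divide_le_eq mult.commute mult_left_mono)
\<comment> \<open>For gcd 0 the quotient is 0 by the convention on division by zero.\<close>
qed (use assms in auto)

lemma vec_maxnorm_eq_0_iff: "vec_maxnorm q = 0 \<longleftrightarrow> q = 0"
proof
  assume q: "vec_maxnorm q = 0"
  have "nat \<bar>q $ j\<bar> \<le> vec_maxnorm q" for j unfolding vec_maxnorm_def by (rule Max_ge) auto
  then show "q = 0" using q by (simp add: vec_eq_iff)
qed (simp add: vec_maxnorm_def)

lemma sum_over_maxnorm_spheres:
  fixes f :: "nat \<Rightarrow> real" and F :: "(int ^ 'n::finite) set"
  assumes F: "finite F" "0 \<notin> F" and f: "\<And>r. f r \<ge> 0"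
  shows "\<exists>R. (\<Sum>q\<in>F. f (vec_maxnorm q))
           \<le> (\<Sum>r=1..R. real CARD('n) * 2 * 3 ^ (CARD('n) - 1) * (real r ^ (CARD('n) - 1) * f r))"
proof -
  \<comment> \<open>Inserting 0 gives \<open>Max\<close> a nonempty set when \<open>F\<close> is
    empty.\<close>
  define R where "R = Max (insert 0 (vec_maxnorm ` F))"
  have R: "vec_maxnorm q \<in> {1..R}" if "q \<in> F" for q
  proof -
    have "vec_maxnorm q \<le> R" unfolding R_def using F that by (intro Max_ge) auto
    moreover have "vec_maxnorm q \<noteq> 0" using F that by (metis vec_maxnorm_eq_0_iff)
    ultimately show ?thesis by simp
  qed
  have "(\<Sum>q\<in>F. f (vec_maxnorm q)) = (\<Sum>r=1..R. \<Sum>q | q \<in> F \<and> vec_maxnorm q = r. f (vec_maxnorm q))"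
    by (rule sum.group[symmetric]) (use F R in auto)
  also have "\<dots> = (\<Sum>r=1..R. real (card {q \<in> F. vec_maxnorm q = r}) * f r)"
    by (intro sum.cong) auto
  also have "\<dots> \<le> (\<Sum>r=1..R. (real CARD('n) * 2 * 3 ^ (CARD('n) - 1) * real r ^ (CARD('n) - 1)) * f r)"
  proof (intro sum_mono mult_right_mono f)
    fix r assume "r \<in> {1..R}"
    then have r: "r \<ge> 1" by simp
    have "card {q \<in> F. vec_maxnorm q = r} \<le> card {q :: int ^ 'n. vec_maxnorm q = r}"
      by (intro card_mono maxnorm_sphere r) auto
    then show "real (card {q \<in> F. vec_maxnorm q = r})
        \<le> real CARD('n) * 2 * 3 ^ (CARD('n) - 1) * real r ^ (CARD('n) - 1)"
      using maxnorm_sphere(2)[where 'n = 'n, OF r] by linarith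
  qed
  finally show ?thesis by (auto simp: mult.assoc)
qed

text \<open>By contradiction: bounded sums over the slices bound the weighted sums of the capped
  terms \<open>e r\<close>. Hence the cap is active for only finitely many \<open>r\<close>, and
  since spheres exceed slices by at most a constant factor, the whole series would be
  finite.\<close>

lemma primitive_slices_sum_unbounded:
  fixes \<psi> :: "nat \<Rightarrow> real" and i :: "'n::finite"
  assumes n: "CARD('n) > 2" and \<psi>: "\<And>k. \<psi> k \<ge> 0"
    and div: "(\<Sum>\<^sub>\<infinity>q\<in>UNIV - {0 :: int ^ 'n}.
            ennreal ((real (totient (nat (vec_gcd q))) * \<psi> (vec_maxnorm q)
                        / real_of_int (vec_gcd q)) ^ m)) = \<infinity>"
  shows "\<exists>F. finite F \<and> F \<subseteq> (\<Union>r\<in>{1..}. primitive_slice i r) \<and>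
           K \<le> (\<Sum>q\<in>F. (2 * min (\<psi> (vec_maxnorm q)) (1 / 2)) ^ m)"
proof (rule ccontr)
  define e where "e r = (2 * min (\<psi> r) (1 / 2)) ^ m" for r
  let ?k = "CARD('n) - 1"
  let ?C = "real CARD('n) * 2 * 3 ^ ?k"
  assume "\<not> ?thesis"
  then have K: "(\<Sum>q\<in>F. e (vec_maxnorm q)) < K" if "finite F" "F \<subseteq> (\<Union>r\<in>{1..}. primitive_slice i r)" for F
    using that by (force simp: e_def not_le)
  have e0: "e r \<ge> 0" for r using \<psi>[of r] by (simp add: e_def)
  have partial: "(\<Sum>r=1..R. real r ^ ?k * e r) \<le> 4 * K" for R
  proof -
    have "(\<Sum>r=1..R. real r ^ ?k / 4 * e r) \<le> (\<Sum>r=1..R. real (card (primitive_slice i r)) * e r)"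
      using n by (intro sum_mono mult_right_mono e0 card_primitive_slice_ge) auto
    also have "\<dots> = (\<Sum>r=1..R. \<Sum>q\<in>primitive_slice i r. e (vec_maxnorm q))"
      by (intro sum.cong) (auto simp: vec_maxnorm_primitive_slice)
    also have "\<dots> = (\<Sum>q\<in>(\<Union>r\<in>{1..R}. primitive_slice i r). e (vec_maxnorm q))"
      by (rule sum.UNION_disjoint[symmetric])
        (auto simp: finite_primitive_slice dest: vec_maxnorm_primitive_slice)
    also have "\<dots> \<le> K" by (rule less_imp_le[OF K]) (auto simp: finite_primitive_slice)
    finally show ?thesis by (simp add: sum_divide_distrib[symmetric])
  qed
  \<comment> \<open>Past \<open>R0\<close> one has \<open>r > 4 * K\<close>, whereas
    \<open>r * e r \<le> 4 * K\<close> by the partial sums; so \<open>e r\<close> drops below 1, the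
    value that it takes whenever the cap is active.\<close>
  define R0 where "R0 = nat \<lceil>4 * K\<rceil>"
  \<comment> \<open>\<open>g\<close> absorbs the finitely many radii at which the cap may be
    active.\<close>
  define g where "g r = (if r \<le> R0 then \<psi> r ^ m else 0)" for r
  have g0: "g r \<ge> 0" for r using \<psi> by (simp add: g_def)
  have small: "\<psi> r ^ m \<le> e r + g r" if r: "r \<ge> 1" for r
  proof (cases "r \<le> R0")
    case False
    have "real r * e r \<le> real r ^ ?k * e r"
      using r n by (intro mult_right_mono e0 self_le_power) auto
    also have "\<dots> \<le> (\<Sum>r=1..r. real r ^ ?k * e r)"
      by (rule member_le_sum) (use r e0 in auto)
    also have "\<dots> \<le> 4 * K" by (rule partial)
    also have "\<dots> < real r" using False unfolding R0_def by linarith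
    finally have "e r < 1" using r by simp
    moreover have "e r = 1" if "\<not> \<psi> r < 1/2"
    proof -
      have "min (\<psi> r) (1/2) = 1/2" using that by simp
      then show ?thesis by (simp add: e_def)
    qed
    ultimately have "\<psi> r < 1/2" by fastforce
    then have "e r = (2 * \<psi> r) ^ m" by (simp add: e_def)
    then show ?thesis using \<psi>[of r] g0[of r] power_mono[of "\<psi> r" "2 * \<psi> r" m] by simp
  qed (simp add: g_def e0)
  \<comment> \<open>The sphere constant times the bounds for the \<open>e\<close> part and the
    \<open>g\<close> part; it depends on no finite set \<open>F\<close>.\<close>
  define B where "B = ?C * (4 * K) + ?C * (\<Sum>r=1..R0. real r ^ ?k * g r)"
  have "(\<Sum>\<^sub>\<infinity>q\<in>UNIV - {0 :: int ^ 'n}.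
            ennreal ((real (totient (nat (vec_gcd q))) * \<psi> (vec_maxnorm q)
                        / real_of_int (vec_gcd q)) ^ m)) \<le> ennreal B"
  proof (rule infsum_le_finite_sums)
    fix F :: "(int ^ 'n) set" assume F: "finite F" "F \<subseteq> UNIV - {0}"
    obtain R where "(\<Sum>q\<in>F. \<psi> (vec_maxnorm q) ^ m) \<le> (\<Sum>r=1..R. ?C * (real r ^ ?k * \<psi> r ^ m))"
      using sum_over_maxnorm_spheres[of F "\<lambda>r. \<psi> r ^ m"] F \<psi> by auto
    also have "\<dots> \<le> (\<Sum>r=1..R. ?C * (real r ^ ?k * (e r + g r)))"
      by (intro sum_mono mult_left_mono small) auto
    also have "\<dots> = ?C * (\<Sum>r=1..R. real r ^ ?k * e r) + ?C * (\<Sum>r=1..R. real r ^ ?k * g r)"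
      by (simp add: sum_distrib_left sum.distrib algebra_simps)
    finally have 1: "(\<Sum>q\<in>F. \<psi> (vec_maxnorm q) ^ m)
        \<le> ?C * (\<Sum>r=1..R. real r ^ ?k * e r) + ?C * (\<Sum>r=1..R. real r ^ ?k * g r)" .
    have 2: "(\<Sum>r=1..R. real r ^ ?k * g r) \<le> (\<Sum>r=1..R0. real r ^ ?k * g r)"
    proof -
      have "(\<Sum>r=1..R. real r ^ ?k * g r) = (\<Sum>r\<in>{1..R} \<inter> {1..R0}. real r ^ ?k * g r)"
        by (rule sum.mono_neutral_right) (auto simp: g_def)
      also have "\<dots> \<le> (\<Sum>r=1..R0. real r ^ ?k * g r)"
        by (rule sum_mono2) (auto simp: g0)
      finally show ?thesis .
    qed
    have bound: "(\<Sum>q\<in>F. \<psi> (vec_maxnorm q) ^ m) \<le> B"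
      unfolding B_def by (rule order_trans[OF 1]) (intro add_mono mult_left_mono partial 2; simp)
    have "(\<Sum>q\<in>F. ennreal ((real (totient (nat (vec_gcd q))) * \<psi> (vec_maxnorm q)
                        / real_of_int (vec_gcd q)) ^ m)) \<le> (\<Sum>q\<in>F. ennreal (\<psi> (vec_maxnorm q) ^ m))"
      by (intro sum_mono ennreal_leI power_mono totient_ratio_le) (auto simp: \<psi> vec_gcd_nonneg)
    also have "\<dots> = ennreal (\<Sum>q\<in>F. \<psi> (vec_maxnorm q) ^ m)"
      using \<psi> by (intro sum_ennreal) simp
    also have "\<dots> \<le> ennreal B" using bound by (rule ennreal_leI)
    finally show "(\<Sum>q\<in>F. ennreal ((real (totient (nat (vec_gcd q))) * \<psi> (vec_maxnorm q)
                        / real_of_int (vec_gcd q)) ^ m)) \<le> ennreal B" .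
  qed (simp add: nonneg_summable_on_complete)
  then show False using div by (simp add: top_unique)
qed

subsection \<open>Systems of linear forms\<close>

lemma ball_Basis_vec: "(\<forall>b\<in>Basis. P (b :: real ^ 'm::finite)) \<longleftrightarrow> (\<forall>i. P (axis i 1))"
  by (auto simp: Basis_vec_def)

lemma ball_Basis_mat: "(\<forall>b\<in>Basis. P (b :: real ^ 'm::finite ^ 'n::finite)) \<longleftrightarrow> (\<forall>i j. P (axis i (axis j 1)))"
  by (auto simp: Basis_vec_def)

lemma int_lattice_prod: "(u, v) \<in> int_lattice \<longleftrightarrow> u \<in> int_lattice \<and> v \<in> int_lattice"
  by (simp add: int_lattice_def Basis_prod_def ball_Un)

lemma unit_cell_prod: "unit_cell (u, v) = unit_cell u \<times> unit_cell v"
  by (auto simp: unit_cell_def Basis_prod_def ball_Un)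

lemma lattice_periodic_Times:
  "lattice_periodic P \<Longrightarrow> lattice_periodic P' \<Longrightarrow> lattice_periodic (P \<times> P')"
  by (auto simp: lattice_periodic_def int_lattice_prod)

lemma infnorm_less_iff: "infnorm (x :: real ^ 'm::finite) < c \<longleftrightarrow> (\<forall>i. \<bar>x $ i\<bar> < c)"
  by (simp add: infnorm_vec_eq_Max)

text \<open>The lift of an open max-norm ball about \<open>y\<close> in the torus. No coprimality is
  imposed on \<open>p\<close>, as it will be applied to primitive \<open>q\<close> only.\<close>

definition int_nbhd :: "real ^ 'm::finite \<Rightarrow> real \<Rightarrow> (real ^ 'm) set" where
  "int_nbhd y c = {v. \<exists>p. infnorm (v - vec_of_int p - y) < c}"

lemma int_nbhd_borel [measurable]: "int_nbhd y c \<in> sets borel"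
proof -
  have "open {v. infnorm (v - vec_of_int p - y) < c}" for p
    by (intro open_Collect_less continuous_intros)
  moreover have "int_nbhd y c = (\<Union>p. {v. infnorm (v - vec_of_int p - y) < c})"
    by (auto simp: int_nbhd_def)
  ultimately have "open (int_nbhd y c)" by auto
  then show ?thesis by simp
qed

lemma lattice_periodic_int_nbhd: "lattice_periodic (int_nbhd (y :: real ^ 'm::finite) c)"
  unfolding lattice_periodic_def
proof (intro ballI allI)
  fix z x :: "real ^ 'm" assume "z \<in> int_lattice"
  then have "z $ i = of_int \<lfloor>z $ i\<rfloor>" for i
    by (simp add: int_lattice_def ball_Basis_vec inner_axis)
  then have z: "z = vec_of_int (\<chi> i. \<lfloor>z $ i\<rfloor>)"
    by (simp add: vec_of_int_def vec_eq_iff)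
  define k where "k = (\<chi> i. \<lfloor>z $ i\<rfloor>)"
  have "x + z - vec_of_int p - y = x - vec_of_int (p - k) - y"
    and "x - vec_of_int p - y = x + z - vec_of_int (p + k) - y" for p
    using z by (simp_all add: k_def vec_of_int_def vec_eq_iff)
  then show "x + z \<in> int_nbhd y c \<longleftrightarrow> x \<in> int_nbhd y c"
    by (simp only: int_nbhd_def mem_Collect_eq) metis
qed

text \<open>In the cell centred at \<open>y\<close> a radius of at most 1/2 lets only the translate
  \<open>p = 0\<close> contribute, so the set is a single open cube of side
  \<open>2 * c\<close>.\<close>

lemma emeasure_unit_cell_int_nbhd:
  fixes y :: "real ^ 'm::finite"
  assumes c: "0 \<le> c" "c \<le> 1 / 2"
  shows "emeasure lborel (unit_cell y \<inter> int_nbhd y c) = ennreal ((2 * c) ^ CARD('m))"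
proof -
  let ?l = "\<chi> i. y $ i - c" and ?u = "\<chi> i. y $ i + c"
  have "unit_cell y \<inter> int_nbhd y c = box ?l ?u"
  proof (intro set_eqI iffI)
    fix v assume v: "v \<in> unit_cell y \<inter> int_nbhd y c"
    then obtain p where p: "\<bar>v $ i - of_int (p $ i) - y $ i\<bar> < c" for i
      by (auto simp: int_nbhd_def infnorm_less_iff vec_of_int_def)
    have "\<bar>v $ i - y $ i\<bar> < c" for i
    proof -
      have "- (1/2) \<le> v $ i - y $ i" "v $ i - y $ i < 1/2"
        using v unfolding unit_cell_def by (auto simp: ball_Basis_vec inner_axis)
      \<comment> \<open>The two distances add up to less than 1/2 + \<open>c\<close>, which is at
        most 1.\<close>
      then have "\<bar>p $ i\<bar> < 1" using p[of i] c by linarith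
      then have "p $ i = 0" by simp
      then show ?thesis using p[of i] by simp
    qed
    then show "v \<in> box ?l ?u" by (auto simp: mem_box_cart abs_less_iff algebra_simps)
  next
    fix v assume "v \<in> box ?l ?u"
    then have v: "\<bar>v $ i - y $ i\<bar> < c" for i
      by (auto simp: mem_box_cart abs_less_iff algebra_simps)
    then have "v \<in> int_nbhd y c"
      by (auto simp: int_nbhd_def infnorm_less_iff vec_of_int_def intro!: exI[of _ 0])
    moreover have "- (1/2) \<le> v $ i - y $ i \<and> v $ i - y $ i < 1/2" for i
      using v[of i] c by linarith
    then have "v \<in> unit_cell y"
      by (simp add: unit_cell_def ball_Basis_vec inner_axis)
    ultimately show "v \<in> unit_cell y \<inter> int_nbhd y c" by simp
  qed
  also have "emeasure lborel (box ?l ?u) = ennreal (\<Prod>b\<in>Basis. (?u - ?l) \<bullet> b)"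
    using c by (intro emeasure_lborel_box) (auto simp: Basis_vec_def inner_axis)
  also have "(\<Prod>b\<in>Basis. (?u - ?l) \<bullet> b) = (\<Prod>b\<in>(Basis :: (real ^ 'm) set). 2 * c)"
    by (intro prod.cong) (auto simp: Basis_vec_def inner_axis)
  finally show ?thesis by simp
qed

section \<open>Surjectivity and independence of integer linear forms\<close>

lemma linear_vector_matrix_mult_right:
  fixes v :: "real ^ 'n::finite"
  shows "linear (\<lambda>x :: real ^ 'm::finite ^ 'n. v v* x)"
  by (rule linearI)
    (simp_all add: vector_matrix_mult_def vec_eq_iff algebra_simps sum.distrib sum_distrib_left)

lemma vec_of_int_mult_int_lattice:
  assumes "x \<in> int_lattice"
  shows "vec_of_int q v* (x :: real ^ 'm::finite ^ 'n::finite) \<in> int_lattice"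
  using assms
  by (auto simp: int_lattice_def ball_Basis_vec ball_Basis_mat inner_axis vector_matrix_mult_def vec_of_int_def
      intro!: Ints_sum)

lemma surj_linear_form:
  fixes q :: "real ^ 'n::finite"
  assumes "q $ i \<noteq> 0"
  shows "surj (\<lambda>x :: real ^ 'm::finite ^ 'n. q v* x)"
proof -
  \<comment> \<open>A preimage of \<open>u\<close> is the matrix whose only nonzero row is row
    \<open>i\<close>, scaled by the inverse of \<open>q $ i\<close>.\<close>
  have "q v* (\<chi> k. if k = i then (1 / q $ i) *\<^sub>R u else 0) = u" for u :: "real ^ 'm"
    using assms by (simp add: vec_eq_iff vector_matrix_mult_def if_distrib[of "\<lambda>v. v $ _"]
        if_distrib[of "\<lambda>a. a * _"] if_distrib[of "\<lambda>a. _ * a"] cong: if_cong)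
  then show ?thesis by (rule surjI)
qed

lemma surj_two_linear_forms:
  fixes q r :: "real ^ 'n::finite"
  assumes D: "q $ i * r $ j - q $ j * r $ i \<noteq> 0"
  shows "surj (\<lambda>x :: real ^ 'm::finite ^ 'n. (q v* x, r v* x))"
proof -
  define D where "D = q $ i * r $ j - q $ j * r $ i"
  have ij: "i \<noteq> j" using D by auto
  have "\<exists>x :: real ^ 'm ^ 'n. (q v* x, r v* x) = (u, v)" for u v :: "real ^ 'm"
  proof
    \<comment> \<open>Rows \<open>i\<close> and \<open>j\<close> of the preimage come from Cramer's
      rule for the two equations with right-hand sides \<open>u\<close> and \<open>v\<close>; all
      other rows vanish.\<close>
    define s where "s = (1 / D) *\<^sub>R (r $ j *\<^sub>R u - q $ j *\<^sub>R v)"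
    define t where "t = (1 / D) *\<^sub>R (q $ i *\<^sub>R v - r $ i *\<^sub>R u)"
    let ?x = "(\<chi> k. if k = i then s else if k = j then t else 0) :: real ^ 'm ^ 'n"
    have x: "(w v* ?x) $ l = w $ i * s $ l + w $ j * t $ l" for w l
    proof -
      have "(w v* ?x) $ l = (\<Sum>k\<in>UNIV. (if k = i then w $ i * s $ l else 0) + (if k = j then w $ j * t $ l else 0))"
        unfolding vector_matrix_mult_def using ij by (auto intro!: sum.cong)
      then show ?thesis by (simp add: sum.distrib)
    qed
    have "q $ i * s $ l + q $ j * t $ l = (q $ i * r $ j - q $ j * r $ i) * u $ l / D"
      "r $ i * s $ l + r $ j * t $ l = (q $ i * r $ j - q $ j * r $ i) * v $ l / D" for l
      by (simp_all add: s_def t_def add_divide_distrib diff_divide_distrib algebra_simps)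
    then show "(q v* ?x, r v* ?x) = (u, v)"
      using assms by (simp add: vec_eq_iff x flip: D_def)
  qed
  then show ?thesis unfolding surj_def by (metis prod.collapse)
qed

text \<open>If all these minors vanish, then \<open>k\<close> times \<open>r\<close> equals
  \<open>l\<close> times \<open>q\<close>. Comparing gcds, both 1, gives \<open>k = l\<close> and
  hence \<open>q = r\<close>.\<close>

lemma primitive_slices_minor_nonzero:
  fixes q r :: "int ^ 'n::finite"
  assumes q: "q \<in> primitive_slice i k" and r: "r \<in> primitive_slice i l" and "k \<ge> 1" "l \<ge> 1" "q \<noteq> r"
  shows "\<exists>j. q $ i * r $ j - q $ j * r $ i \<noteq> 0"
proof (rule ccontr)
  assume "\<not> ?thesis"
  then have eq: "int k * r $ j = int l * q $ j" for j
    using q r by (auto simp: primitive_slice_def mult.commute)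
  have scale: "int a * vec_gcd v = (GCD j\<in>UNIV. int a * v $ j)" for a and v :: "int ^ 'n"
  proof -
    have "range (\<lambda>j. int a * v $ j) = (*) (int a) ` range (\<lambda>j. v $ j)" by auto
    then show ?thesis using vec_gcd_nonneg[of v] by (simp only: vec_gcd_def Gcd_mult) (simp add: abs_mult)
  qed
  have "int k * vec_gcd r = int l * vec_gcd q"
    unfolding scale eq ..
  then have "k = l" using q r by (simp add: primitive_slice_def)
  then have "q = r" using eq assms by (simp add: vec_eq_iff)
  then show False using assms by simp
qed

text \<open>The pair of forms is one surjective map to the product torus, where a product set has
  product measure. This is the source of pairwise independence.\<close>

lemma emeasure_two_linear_forms:
  fixes y :: "real ^ 'm::finite" and q r :: "int ^ 'n::finite" and w :: "real ^ 'm ^ 'n"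
  assumes D: "q $ i * r $ j - q $ j * r $ i \<noteq> 0"
    and P: "P \<in> sets borel" "lattice_periodic P" and P': "P' \<in> sets borel" "lattice_periodic P'"
  shows "emeasure lborel {x \<in> unit_cell w. vec_of_int q v* x \<in> P \<and> vec_of_int r v* x \<in> P'}
    = emeasure lborel (unit_cell y \<inter> P) * emeasure lborel (unit_cell y \<inter> P')"
proof -
  let ?T = "\<lambda>x :: real ^ 'm ^ 'n. (vec_of_int q v* x, vec_of_int r v* x)"
  have "emeasure lborel {x \<in> unit_cell w. vec_of_int q v* x \<in> P \<and> vec_of_int r v* x \<in> P'}
      = emeasure lborel {x \<in> unit_cell w. ?T x \<in> P \<times> P'}" by simp
  also have "\<dots> = emeasure lborel (unit_cell (y, y) \<inter> (P \<times> P'))"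
  proof (rule emeasure_unit_cell_surj_linear)
    show "linear ?T"
      using linear_vector_matrix_mult_right[where 'm = 'm, of "vec_of_int q"]
        linear_vector_matrix_mult_right[where 'm = 'm, of "vec_of_int r"]
      by (auto simp: linear_iff)
    show "surj ?T"
    proof (rule surj_two_linear_forms)
      have "vec_of_int q $ i * vec_of_int r $ j - vec_of_int q $ j * vec_of_int r $ i
          = of_int (q $ i * r $ j - q $ j * r $ i)" by (simp add: vec_of_int_def)
      then show "vec_of_int q $ i * vec_of_int r $ j - vec_of_int q $ j * vec_of_int r $ i \<noteq> 0"
        using D by (metis of_int_eq_0_iff)
    qed
    show "?T ` int_lattice \<subseteq> int_lattice"
      by (auto simp: int_lattice_prod vec_of_int_mult_int_lattice)
    show "P \<times> P' \<in> sets borel" using P P' by (intro borel_Times)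
    show "lattice_periodic (P \<times> P')" using P P' by (intro lattice_periodic_Times)
  qed
  also have "unit_cell (y, y) \<inter> (P \<times> P') = (unit_cell y \<inter> P) \<times> (unit_cell y \<inter> P')"
    by (auto simp: unit_cell_prod)
  also have "emeasure lborel \<dots> = emeasure lborel (unit_cell y \<inter> P) * emeasure lborel (unit_cell y \<inter> P')"
    unfolding lborel_prod[symmetric]
    using P P' by (intro lborel.emeasure_pair_measure_Times) auto
  finally show ?thesis .
qed

section \<open>Borel--Cantelli on each unit cell and passage to the whole space\<close>

theorem theorem2p3:
  fixes y :: "real ^ 'm::finite"
    and \<psi> :: "nat \<Rightarrow> real"
  assumes "CARD('n::finite) > 2"
    and "\<And>k. \<psi> k \<ge> 0"
    and "(\<Sum>\<^sub>\<infinity>q\<in>UNIV - {0 :: int ^ 'n}.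
            ennreal ((real (totient (nat (vec_gcd q))) * \<psi> (vec_maxnorm q)
                        / real_of_int (vec_gcd q)) ^ CARD('m))) = \<infinity>"
  shows "AE x :: real ^ 'm ^ 'n in lebesgue.
           infinite {(p :: int ^ 'm, q :: int ^ 'n).
             (\<forall>i. gcd (p $ i) (vec_gcd q) = 1) \<and>
             infnorm (vec_of_int q v* x - vec_of_int p - y) < \<psi> (vec_maxnorm q)}"
proof -
  \<comment> \<open>Any coordinate may be pinned.\<close>
  obtain i :: 'n where True by simp
  define Q where "Q = (\<Union>r\<in>{1..}. primitive_slice i r)"
  \<comment> \<open>The cap at 1/2 only shrinks the target sets and brings them within reach of the
    exact measure formula.\<close>
  define c where "c q = min (\<psi> (vec_maxnorm q)) (1 / 2)" for q :: "int ^ 'n"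
  have c: "0 \<le> c q" "c q \<le> 1 / 2" for q using assms(2)[of "vec_maxnorm q"] by (auto simp: c_def)
  \<comment> \<open>Lebesgue measure restricted to one cell is a probability measure, so
    Borel--Cantelli applies there.\<close>
  have cell: "AE x in lborel. x \<in> unit_cell w \<longrightarrow> infinite {q \<in> Q. vec_of_int q v* x \<in> int_nbhd y (c q)}"
    for w :: "real ^ 'm ^ 'n"
  proof -
    define M where "M = restrict_space lborel (unit_cell w)"
    define A where "A q = {x \<in> unit_cell w. vec_of_int q v* x \<in> int_nbhd y (c q)}" for q :: "int ^ 'n"
    have em: "emeasure M B = emeasure lborel B" if "B \<subseteq> unit_cell w" for B
      unfolding M_def using that by (intro emeasure_restrict_space) auto
    have space: "space M = unit_cell w" by (simp add: M_def space_restrict_space)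
    interpret prob_space M
      by (rule prob_spaceI) (simp add: space em emeasure_unit_cell)
    have A: "A q \<in> sets M" for q
    proof -
      have [measurable]: "(\<lambda>x :: real ^ 'm ^ 'n. vec_of_int q v* x) \<in> borel_measurable borel"
        using linear_vector_matrix_mult_right
        by (intro borel_measurable_continuous_onI linear_continuous_on) (simp add: linear_conv_bounded_linear)
      have "{x \<in> space lborel. x \<in> unit_cell w \<and> vec_of_int q v* x \<in> int_nbhd y (c q)} \<in> sets lborel"
        by measurable
      then have "A q \<in> sets lborel" by (simp add: A_def)
      then show ?thesis unfolding M_def by (subst sets_restrict_space_iff) (auto simp: A_def)
    qed
    have pair: "emeasure M {x \<in> unit_cell w. vec_of_int q v* x \<in> P \<and> vec_of_int r v* x \<in> P'}
        = emeasure lborel (unit_cell y \<inter> P) * emeasure lborel (unit_cell y \<inter> P')"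
      if qr: "q \<in> Q" "r \<in> Q" "q \<noteq> r" and P: "P \<in> sets borel" "lattice_periodic P" "P' \<in> sets borel" "lattice_periodic P'"
      for q r P P'
    proof -
      obtain k l where "q \<in> primitive_slice i k" "r \<in> primitive_slice i l" "k \<ge> 1" "l \<ge> 1"
        using qr by (auto simp: Q_def)
      then obtain j where "q $ i * r $ j - q $ j * r $ i \<noteq> 0"
        using primitive_slices_minor_nonzero qr(3) by blast
      from emeasure_two_linear_forms[OF this P] show ?thesis by (subst em) auto
    qed
    have single: "emeasure M (A q) = ennreal ((2 * c q) ^ CARD('m))" if "q \<in> Q" for q
    proof -
      have T: "linear (\<lambda>x :: real ^ 'm ^ 'n. vec_of_int q v* x)"
        by (rule linear_vector_matrix_mult_right)
      have S: "surj (\<lambda>x :: real ^ 'm ^ 'n. vec_of_int q v* x)"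
        using that by (intro surj_linear_form[of _ i]) (auto simp: Q_def primitive_slice_def vec_of_int_def)
      have L: "(\<lambda>x :: real ^ 'm ^ 'n. vec_of_int q v* x) ` int_lattice \<subseteq> int_lattice"
        by (intro image_subsetI vec_of_int_mult_int_lattice)
      have "emeasure M (A q) = emeasure lborel (A q)" by (rule em) (auto simp: A_def)
      also have "\<dots> = emeasure lborel (unit_cell y \<inter> int_nbhd y (c q))"
        unfolding A_def
        by (rule emeasure_unit_cell_surj_linear[OF T S L int_nbhd_borel lattice_periodic_int_nbhd])
      finally show ?thesis unfolding emeasure_unit_cell_int_nbhd[OF c] .
    qed
    have "AE x in M. infinite {q \<in> Q. x \<in> A q}"
    proof (rule AE_infinite_pairwise_indep)
      show "countable Q" by simp
      show "A q \<in> events" for q by (rule A)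
      show "prob (A q \<inter> A r) = prob (A q) * prob (A r)" if "q \<in> Q" "r \<in> Q" "q \<noteq> r" for q r
      proof -
        have "A q \<inter> A r = {x \<in> unit_cell w. vec_of_int q v* x \<in> int_nbhd y (c q) \<and> vec_of_int r v* x \<in> int_nbhd y (c r)}"
          by (auto simp: A_def)
        then have "emeasure M (A q \<inter> A r) = emeasure M (A q) * emeasure M (A r)"
          using pair[OF that int_nbhd_borel lattice_periodic_int_nbhd int_nbhd_borel lattice_periodic_int_nbhd]
          by (simp only: single that emeasure_unit_cell_int_nbhd[OF c])
        then show ?thesis by (simp add: measure_def enn2real_mult)
      qed
      show "\<exists>F. finite F \<and> F \<subseteq> Q \<and> K \<le> (\<Sum>q\<in>F. prob (A q))" for K
      proof -
        obtain F where F: "finite F" "F \<subseteq> Q" "K \<le> (\<Sum>q\<in>F. (2 * c q) ^ CARD('m))"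
          using primitive_slices_sum_unbounded[OF assms, of i K] unfolding Q_def c_def by blast
        have "(\<Sum>q\<in>F. (2 * c q) ^ CARD('m)) = (\<Sum>q\<in>F. prob (A q))"
          using F(2) c by (intro sum.cong) (auto simp: measure_def single subset_iff)
        then show ?thesis using F by auto
      qed
    qed
    then show ?thesis
      unfolding M_def by (subst (asm) AE_restrict_space_iff) (auto simp: A_def elim!: eventually_mono)
  qed
  \<comment> \<open>The cells centred at lattice points are countably many and cover the space, so
    the exceptional null sets can be united.\<close>
  have "AE x :: real ^ 'm ^ 'n in lborel. \<forall>w\<in>int_lattice. x \<in> unit_cell w \<longrightarrow>
      infinite {q \<in> Q. vec_of_int q v* x \<in> int_nbhd y (c q)}"
    using cell by (subst AE_ball_countable) (auto simp: countable_int_lattice)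
  then have "AE x :: real ^ 'm ^ 'n in lborel. infinite {q \<in> Q. vec_of_int q v* x \<in> int_nbhd y (c q)}"
  proof eventually_elim
    case (elim x)
    then show ?case using ex1_lattice_translate[of x 0] by auto
  qed
  then have "AE x :: real ^ 'm ^ 'n in lebesgue. infinite {q \<in> Q. vec_of_int q v* x \<in> int_nbhd y (c q)}"
    by (rule AE_completion)
  then show ?thesis
  proof eventually_elim
    case (elim x)
    let ?S = "{(p :: int ^ 'm, q :: int ^ 'n). (\<forall>i. gcd (p $ i) (vec_gcd q) = 1) \<and>
             infnorm (vec_of_int q v* x - vec_of_int p - y) < \<psi> (vec_maxnorm q)}"
    \<comment> \<open>Each such \<open>q\<close> has gcd 1 and so comes with an admissible
      \<open>p\<close>; infinitely many second components force infinitely many pairs.\<close>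
    have "{q \<in> Q. vec_of_int q v* x \<in> int_nbhd y (c q)} \<subseteq> snd ` ?S"
    proof
      fix q assume "q \<in> {q \<in> Q. vec_of_int q v* x \<in> int_nbhd y (c q)}"
      then obtain p where "q \<in> Q" "infnorm (vec_of_int q v* x - vec_of_int p - y) < c q"
        by (auto simp: int_nbhd_def)
      then have "(p, q) \<in> ?S" by (auto simp: c_def Q_def primitive_slice_def)
      then show "q \<in> snd ` ?S" by (rule image_eqI[rotated]) simp
    qed
    then show ?case using elim finite_subset[OF _ finite_imageI] by blast
  qed
qed

end
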